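(* Let $A=\operatorname{diag}(\lambda_1,\dots,\lambda_n)$ with $\lambda_i\in\mathbb C$. For the functional $\rho_A(u)$, the negative gradient flow induces on the probability simplex, in the variables $p_i=|u_i|^2$, the flow \[ \dot p_i=4p_i\left(\rho(p)-|\lambda_i-z(p)|^2\right),\qquad i=1,\dots,n. \]
   Context: For a unit vector $u=(u_1,\dots,u_n)^T\in\mathbb C^n$, $\rho_A(u)=\|Au-(u^*Au)u\|^2$. Put $p_i=|u_i|^2$, so $p=(p_1,\dots,p_n)$ lies in the simplex $\Delta^{n-1}=\{p_i\ge0,\ \sum_ip_i=1\}$, and $z(p)=\sum_ip_i\lambda_i=u^*Au$, $\rho(p)=\sum_ip_i|\lambda_i-z(p)|^2=\rho_A(u)$. The negative gradient flow is $\dot u=-g_A(u)$, where $g_A(u)=2\bigl((A^*-\overline zI)(A-zI)u-\rho_A(u)u\bigr)$ with $z=u^*Au$; this is the gradient of $\rho_A$ on $\mathbb{CP}^{n-1}$ for the Fubini--Study metric normalized as $\operatorname{Re}(h^*h')$ on the horizontal space $\{h:u^*h=0\}$. *)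

theory Defs
  imports "HOL-Analysis.Analysis"
begin

definition cinner :: "complex ^ 'n \<Rightarrow> complex ^ 'n \<Rightarrow> complex" where
  "cinner u v = (\<Sum>i\<in>UNIV. cnj (u $ i) * v $ i)"

definition cadjoint :: "complex ^ 'n ^ 'm \<Rightarrow> complex ^ 'm ^ 'n" where
  "cadjoint A = (\<chi> i j. cnj (A $ j $ i))"

definition diag_matrix :: "complex ^ 'n \<Rightarrow> complex ^ 'n ^ 'n" where
  "diag_matrix lam = (\<chi> i j. if i = j then lam $ i else 0)"

definition rho_op :: "complex ^ 'n ^ 'n \<Rightarrow> complex ^ 'n \<Rightarrow> real" where
  "rho_op A u = (norm (A *v u - cinner u (A *v u) *s u))\<^sup>2"

(* This is the gradient of rho_op A for the Fubini--Study metric normalised as Re (h^* h'),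
   represented by its horizontal lift to the unit sphere; this is verified in the lemmas
   grad_rho_horizontal, grad_rho_is_gradient and grad_rho_phase below. *)
definition grad_rho :: "complex ^ 'n ^ 'n \<Rightarrow> complex ^ 'n \<Rightarrow> complex ^ 'n" where
  "grad_rho A u =
     (let z = cinner u (A *v u)
      in 2 *\<^sub>R ((cadjoint A - mat (cnj z)) *v ((A - mat z) *v u) - rho_op A u *\<^sub>R u))"

(* Integral curves on the unit sphere.  The time set T is arbitrary; for an interval
   containing an endpoint, the derivative there is one-sided. *)
definition neg_gradient_flow_curve ::
  "complex ^ 'n ^ 'n \<Rightarrow> real set \<Rightarrow> (real \<Rightarrow> complex ^ 'n) \<Rightarrow> bool" where
  "neg_gradient_flow_curve A T u \<longleftrightarrow>
     (\<forall>t\<in>T. norm (u t) = 1 \<and> (u has_vector_derivative - grad_rho A (u t)) (at t within T))"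

definition prob_simplex :: "(real ^ 'n) set" where
  "prob_simplex = {p. (\<forall>i. 0 \<le> p $ i) \<and> (\<Sum>i\<in>UNIV. p $ i) = 1}"

definition prob_coords :: "complex ^ 'n \<Rightarrow> real ^ 'n" where
  "prob_coords u = (\<chi> i. (cmod (u $ i))\<^sup>2)"

definition z_simplex :: "complex ^ 'n \<Rightarrow> real ^ 'n \<Rightarrow> complex" where
  "z_simplex lam p = (\<Sum>i\<in>UNIV. of_real (p $ i) * lam $ i)"

definition rho_simplex :: "complex ^ 'n \<Rightarrow> real ^ 'n \<Rightarrow> real" where
  "rho_simplex lam p = (\<Sum>i\<in>UNIV. p $ i * (cmod (lam $ i - z_simplex lam p))\<^sup>2)"

definition simplex_field :: "complex ^ 'n \<Rightarrow> real ^ 'n \<Rightarrow> real ^ 'n" where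
  "simplex_field lam p =
     (\<chi> i. 4 * p $ i * (rho_simplex lam p - (cmod (lam $ i - z_simplex lam p))\<^sup>2))"


lemma Re_cinner: "Re (cinner x y) = x \<bullet> y"
  by (simp add: cinner_def inner_vec_def inner_complex_def)

lemma cinner_adjoint: "cinner (cadjoint M *v x) y = cinner x (M *v y)"
proof -
  have "cinner (cadjoint M *v x) y
      = (\<Sum>i\<in>UNIV. \<Sum>j\<in>UNIV. M $ j $ i * cnj (x $ j) * y $ i)"
    by (simp add: cinner_def cadjoint_def matrix_vector_mult_def sum_distrib_right)
  also have "\<dots> = (\<Sum>j\<in>UNIV. \<Sum>i\<in>UNIV. M $ j $ i * cnj (x $ j) * y $ i)"
    by (rule sum.swap)
  also have "\<dots> = cinner x (M *v y)"
    by (simp add: cinner_def matrix_vector_mult_def sum_distrib_left mult_ac)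
  finally show ?thesis .
qed

lemma cinner_commute: "cinner y x = cnj (cinner x y)"
  by (simp add: cinner_def mult.commute)

lemma cinner_self: "cinner u u = of_real ((norm u)\<^sup>2)"
proof -
  have "cinner u u = of_real (Re (cinner u u))"
    by (simp add: complex_eq_iff) (simp add: cinner_def mult.commute)
  then show ?thesis by (simp add: Re_cinner power2_norm_eq_inner)
qed

lemma cinner_diff_right: "cinner u (x - y) = cinner u x - cinner u y"
  and cinner_diff_left: "cinner (x - y) u = cinner x u - cinner y u"
  and cinner_scale_right: "cinner u (c *s x) = c * cinner u x"
  by (simp_all add: cinner_def sum_subtractf sum_distrib_left algebra_simps)

lemma cinner_scaleR_right: "cinner u (r *\<^sub>R x) = of_real r * cinner u x"
  unfolding cinner_def vector_scaleR_component mult_scaleR_right scaleR_sum_right[symmetric]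
  by (rule scaleR_conv_of_real)

lemma mat_mult_vec: "mat c *v (x :: complex ^ 'n) = c *s x"
  by (simp add: vec_eq_iff matrix_vector_mult_def mat_def if_distrib if_distribR cong: if_cong)

lemma cadjoint_shift: "cadjoint A - mat (cnj z) = cadjoint (A - mat z)"
  by (simp add: vec_eq_iff cadjoint_def mat_def)

lemma grad_rho_horizontal:
  assumes "norm u = 1"
  shows "cinner u (grad_rho A u) = 0"
proof -
  define z where "z = cinner u (A *v u)"
  define w where "w = A *v u - z *s u"
  have w: "(A - mat z) *v u = w"
    by (simp add: w_def matrix_vector_mult_diff_rdistrib mat_mult_vec)
  have "cinner u (cadjoint (A - mat z) *v w) = cnj (cinner w w)"
    by (subst cinner_commute) (simp add: cinner_adjoint w)
  then show ?thesis using assms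
    by (simp add: grad_rho_def z_def[symmetric] w cadjoint_shift cinner_diff_right
        cinner_scaleR_right cinner_self rho_op_def w_def)
qed

lemma grad_rho_is_gradient:
  assumes "norm u = 1"
  shows "\<exists>D. (rho_op A has_derivative D) (at u) \<and>
             (\<forall>h. cinner u h = 0 \<longrightarrow> D h = Re (cinner (grad_rho A u) h))"
proof -
  define z where "z = cinner u (A *v u)"
  define w where "w = A *v u - z *s u"
  define z' where "z' h = (\<Sum>i\<in>UNIV. cnj (u $ i) * (A *v h) $ i + cnj (h $ i) * (A *v u) $ i)" for h
  define D where "D h = 2 * (w \<bullet> (A *v h - (z' h *s u + z *s h)))" for h
  have wu: "cinner w u = 0"
    using assms cinner_commute[of u w] by (simp add: w_def cinner_diff_right cinner_scale_right cinner_self z_def)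
  have lA: "bounded_linear (\<lambda>v. A *v v)"
    unfolding linear_conv_bounded_linear[symmetric]
    by (rule linearI) (simp_all add: vec_eq_iff matrix_vector_mult_def sum.distrib
        scaleR_sum_right distrib_left)
  have dA: "((\<lambda>v. A *v v) has_derivative (\<lambda>h. A *v h)) (at u)"
    by (rule bounded_linear_imp_has_derivative[OF lA])
  have dAi: "((\<lambda>v. (A *v v) $ i) has_derivative (\<lambda>h. (A *v h) $ i)) (at u)" for i
    by (rule bounded_linear.has_derivative[OF bounded_linear_vec_nth dA])
  have dc: "((\<lambda>v. cnj (v $ i)) has_derivative (\<lambda>h. cnj (h $ i))) (at u)" for i
    by (intro has_derivative_cnj bounded_linear_imp_has_derivative bounded_linear_vec_nth)
  have dz: "((\<lambda>v. cinner v (A *v v)) has_derivative z') (at u)"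
    unfolding cinner_def z'_def by (intro has_derivative_sum has_derivative_mult dc dAi)
  have bs: "bounded_bilinear (\<lambda>(c::complex) (v::complex^'a). c *s v)"
  proof
    show "\<exists>K. \<forall>(c::complex) (v::complex^'a). norm (c *s v) \<le> norm c * norm v * K"
      by (rule exI[of _ 1]) (simp add: norm_vec_def norm_mult L2_set_right_distrib)
  qed (simp_all add: vec_eq_iff algebra_simps)
  have dzs: "((\<lambda>v. cinner v (A *v v) *s v) has_derivative (\<lambda>h. z *s h + z' h *s u)) (at u)"
    unfolding z_def using bounded_bilinear.FDERIV[OF bs dz has_derivative_ident] by simp
  have dw: "((\<lambda>v. A *v v - cinner v (A *v v) *s v) has_derivative
      (\<lambda>h. A *v h - (z *s h + z' h *s u))) (at u)"
    by (intro has_derivative_diff dA dzs)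
  have "(rho_op A has_derivative D) (at u)"
  proof -
    have "rho_op A = (\<lambda>v. (A *v v - cinner v (A *v v) *s v) \<bullet> (A *v v - cinner v (A *v v) *s v))"
      by (simp add: fun_eq_iff rho_op_def power2_norm_eq_inner)
    then show ?thesis
      using has_derivative_inner[OF dw dw]
      by (simp add: D_def[abs_def] w_def z_def inner_commute add.commute)
  qed
  moreover have "D h = Re (cinner (grad_rho A u) h)" if h: "cinner u h = 0" for h
  proof -
    have w: "(A - mat z) *v u = w"
      by (simp add: w_def matrix_vector_mult_diff_rdistrib mat_mult_vec)
    have "cinner w (z' h *s u) = 0"
      by (simp add: cinner_scale_right wu)
    then have 1: "w \<bullet> (z' h *s u) = 0"
      by (metis Re_cinner zero_complex.sel(1))
    have 2: "u \<bullet> h = 0" using h by (metis Re_cinner zero_complex.sel(1))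
    have 3: "(cadjoint (A - mat z) *v w) \<bullet> h = w \<bullet> (A *v h - z *s h)"
      by (simp add: Re_cinner[symmetric] cinner_adjoint matrix_vector_mult_diff_rdistrib mat_mult_vec)
    show ?thesis
      by (simp add: Re_cinner grad_rho_def z_def[symmetric] w cadjoint_shift inner_diff_left 2 3
          D_def inner_diff_right inner_add_right 1)
  qed
  ultimately show ?thesis by blast
qed

lemma grad_rho_phase:
  assumes "cmod c = 1"
  shows "rho_op A (c *s u) = rho_op A u" and "grad_rho A (c *s u) = c *s grad_rho A u"
proof -
  have cc: "cnj c * c = 1"
    using assms by (metis complex_norm_square mult.commute of_real_1 one_power2)
  have l: "M *v (c *s v) = c *s (M *v v)" for M :: "complex ^ 'a ^ 'a" and v
    by (simp add: vec_eq_iff matrix_vector_mult_def sum_distrib_left mult_ac)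
  have z: "cinner (c *s u) (A *v (c *s u)) = cinner u (A *v u)"
    unfolding l cinner_def using cc by (auto intro!: sum.cong simp: mult_ac)
  have n: "norm (c *s v) = norm v" for v :: "complex ^ 'a"
    using assms by (simp add: norm_vec_def norm_mult)
  have d: "c *s (A *v u) - cinner u (A *v u) *s (c *s u) = c *s (A *v u - cinner u (A *v u) *s u)"
    by (simp add: vec_eq_iff right_diff_distrib mult.left_commute)
  show 1: "rho_op A (c *s u) = rho_op A u"
    unfolding rho_op_def z unfolding l d n ..
  have r: "r *\<^sub>R (c *s v) = c *s (r *\<^sub>R v)" for r and v :: "complex ^ 'a"
    by (simp add: vec_eq_iff)
  show "grad_rho A (c *s u) = c *s grad_rho A u"
    unfolding grad_rho_def z Let_def 1
    unfolding l r vector_ssub_ldistrib[symmetric] ..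
qed

end

theory Submission
  imports Defs
begin

text \<open>
  For a diagonal matrix the \<open>i\<close>-th coordinate of \<open>A u - z u\<close> is \<open>(\<lambda>\<^sub>i - z) u\<^sub>i\<close>, and applying
  the adjoint of \<open>A - z I\<close> multiplies it by the conjugate factor. Hence the gradient is \<open>u\<close> with
  each coordinate \<open>u\<^sub>i\<close> multiplied by the \<^emph>\<open>real\<close> number \<open>2 (|\<lambda>\<^sub>i - z|\<^sup>2 - \<rho>)\<close>, which depends
  on \<open>u\<close> only through the squared moduli \<open>p\<^sub>j = |u\<^sub>j|\<^sup>2\<close> (\<open>grad_rho_diag_nth\<close>).

  The differential of \<open>|u\<^sub>i|\<^sup>2\<close> in the direction \<open>h\<close> is \<open>2 Re (cnj u\<^sub>i * h\<^sub>i)\<close>, so for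
  \<open>h\<^sub>i = r u\<^sub>i\<close> with \<open>r\<close> real it equals \<open>2 r p\<^sub>i\<close>; the two factors of \<open>2\<close> give the constant \<open>4\<close>.
  This computes the push-forward of the negative gradient under \<open>prob_coords\<close>
  (\<open>prob_coords_pushforward_neg_grad\<close>), and the chain rule carries it over to integral curves.
\<close>

lemma diag_matrix_mult_nth: "(diag_matrix lam *v u) $ i = lam $ i * u $ i"
  by (simp add: diag_matrix_def matrix_vector_mult_def if_distrib if_distribR cong: if_cong)

lemma cadjoint_diag_matrix: "cadjoint (diag_matrix lam) = diag_matrix (\<chi> i. cnj (lam $ i))"
  by (simp add: vec_eq_iff cadjoint_def diag_matrix_def)

lemma z_simplex_prob_coords:
  "z_simplex lam (prob_coords u) = cinner u (diag_matrix lam *v u)"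
  by (simp add: z_simplex_def prob_coords_def cinner_def diag_matrix_mult_nth
      complex_norm_square mult_ac del: of_real_power)

lemma rho_simplex_prob_coords:
  "rho_simplex lam (prob_coords u) = rho_op (diag_matrix lam) u"
proof -
  have "rho_op (diag_matrix lam) u
      = (\<Sum>i\<in>UNIV. (cmod ((lam $ i - z_simplex lam (prob_coords u)) * u $ i))\<^sup>2)"
    by (simp add: rho_op_def z_simplex_prob_coords norm_vec_def L2_set_def sum_nonneg
        diag_matrix_mult_nth left_diff_distrib)
  then show ?thesis
    by (simp add: rho_simplex_def prob_coords_def norm_mult power_mult_distrib mult.commute)
qed

text \<open>
  Expressing the factor through \<open>prob_coords u\<close> alone is what makes the flow descend to the
  simplex.
\<close>

lemma grad_rho_diag_nth:
  fixes lam u :: "complex ^ 'n"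
  defines "p \<equiv> prob_coords u"
  shows "grad_rho (diag_matrix lam) u $ i
    = (2 * ((cmod (lam $ i - z_simplex lam p))\<^sup>2 - rho_simplex lam p)) *\<^sub>R u $ i"
  unfolding p_def rho_simplex_prob_coords z_simplex_prob_coords
  by (simp add: grad_rho_def Let_def matrix_vector_mult_diff_rdistrib mat_mult_vec
      cadjoint_diag_matrix diag_matrix_mult_nth scaleR_conv_of_real[where 'a = complex] complex_norm_square
      algebra_simps del: of_real_power)

lemma prob_coords_nth: "prob_coords u $ i = u $ i \<bullet> u $ i"
  by (simp add: prob_coords_def power2_norm_eq_inner)

lemma prob_coords_has_derivative:
  "(prob_coords has_derivative (\<lambda>h. \<chi> i. 2 * (u $ i \<bullet> h $ i))) (at u)"
proof -
  have "((\<lambda>v. v $ i \<bullet> v $ i) has_derivative (\<lambda>h. 2 * (u $ i \<bullet> h $ i))) (at u)" for i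
    using has_derivative_inner[OF bounded_linear_imp_has_derivative bounded_linear_imp_has_derivative,
        OF bounded_linear_vec_nth bounded_linear_vec_nth, of i i u UNIV]
    by (simp add: inner_commute)
  then show ?thesis
    unfolding has_derivative_componentwise_within[of prob_coords]
    by (simp add: Basis_vec_def inner_axis prob_coords_nth)
qed

lemma prob_coords_pushforward_neg_grad:
  "(\<chi> i. 2 * (u $ i \<bullet> (- grad_rho (diag_matrix lam) u) $ i)) = simplex_field lam (prob_coords u)"
  by (simp add: vec_eq_iff simplex_field_def grad_rho_diag_nth prob_coords_nth algebra_simps)

text \<open>Real square roots of the probabilities provide a preimage of a point of the simplex.\<close>

lemma prob_coords_image_sphere:
  "prob_coords ` {u :: complex ^ 'n. norm u = 1} = prob_simplex"
proof (intro equalityI subsetI)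
  fix p assume "p \<in> prob_coords ` {u :: complex ^ 'n. norm u = 1}"
  then obtain u :: "complex ^ 'n" where "norm u = 1" and "p = prob_coords u"
    by blast
  then show "p \<in> prob_simplex"
    by (simp add: prob_simplex_def prob_coords_def norm_vec_def L2_set_def)
next
  fix p :: "real ^ 'n" assume p: "p \<in> prob_simplex"
  define u :: "complex ^ 'n" where "u = (\<chi> i. of_real (sqrt (p $ i)))"
  have "norm u = 1" and "p = prob_coords u"
    using p by (simp_all add: u_def prob_simplex_def prob_coords_def norm_vec_def L2_set_def vec_eq_iff)
  then show "p \<in> prob_coords ` {u. norm u = 1}"
    by blast
qed

lemma neg_gradient_flow_curve_prob_coords:
  assumes "neg_gradient_flow_curve (diag_matrix lam) T u" and "t \<in> T"
  shows "((\<lambda>s. prob_coords (u s)) has_vector_derivative simplex_field lam (prob_coords (u t)))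
    (at t within T)"
proof -
  have "(u has_vector_derivative - grad_rho (diag_matrix lam) (u t)) (at t within T)"
    using assms by (simp add: neg_gradient_flow_curve_def)
  from vector_derivative_diff_chain_within[OF this
      has_derivative_at_withinI[OF prob_coords_has_derivative]]
  show ?thesis
    by (simp only: o_def prob_coords_pushforward_neg_grad)
qed

theorem proposition4p1:
  fixes lam :: "complex ^ 'n"
  shows
    "prob_coords ` {u :: complex ^ 'n. norm u = 1} = prob_simplex \<and>
     (\<forall>u. norm u = 1 \<longrightarrow>
        z_simplex lam (prob_coords u) = cinner u (diag_matrix lam *v u) \<and>
        rho_simplex lam (prob_coords u) = rho_op (diag_matrix lam) u \<and>
        (\<exists>D. (prob_coords has_derivative D) (at u) \<and>
             D (- grad_rho (diag_matrix lam) u) = simplex_field lam (prob_coords u))) \<and>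
     (\<forall>T u. neg_gradient_flow_curve (diag_matrix lam) T u \<longrightarrow>
        (\<forall>t\<in>T. \<forall>i.
           ((\<lambda>s. prob_coords (u s) $ i) has_real_derivative
              4 * prob_coords (u t) $ i *
                (rho_simplex lam (prob_coords (u t))
                  - (cmod (lam $ i - z_simplex lam (prob_coords (u t))))\<^sup>2)) (at t within T)))"
proof (intro conjI allI impI ballI)
  show "prob_coords ` {u :: complex ^ 'n. norm u = 1} = prob_simplex"
    by (rule prob_coords_image_sphere)
next
  fix u :: "complex ^ 'n"
  show "z_simplex lam (prob_coords u) = cinner u (diag_matrix lam *v u)"
    by (rule z_simplex_prob_coords)
  show "rho_simplex lam (prob_coords u) = rho_op (diag_matrix lam) u"
    by (rule rho_simplex_prob_coords)
  show "\<exists>D. (prob_coords has_derivative D) (at u) \<and>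
      D (- grad_rho (diag_matrix lam) u) = simplex_field lam (prob_coords u)"
    using prob_coords_has_derivative prob_coords_pushforward_neg_grad by blast
next
  fix T u t i
  assume "neg_gradient_flow_curve (diag_matrix lam) T u" and "t \<in> T"
  then have "((\<lambda>s. prob_coords (u s)) has_vector_derivative simplex_field lam (prob_coords (u t)))
      (at t within T)"
    by (rule neg_gradient_flow_curve_prob_coords)
  from bounded_linear.has_vector_derivative[OF bounded_linear_vec_nth this, of i]
  show "((\<lambda>s. prob_coords (u s) $ i) has_real_derivative
      4 * prob_coords (u t) $ i *
        (rho_simplex lam (prob_coords (u t))
          - (cmod (lam $ i - z_simplex lam (prob_coords (u t))))\<^sup>2)) (at t within T)"
    by (simp add: has_real_derivative_iff_has_vector_derivative simplex_field_def)
qed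

end
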